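(* Let $q$ be a prime power, $r$ a prime with $r\mid(q-1)$ and $r\ge 3$, $q/2\le\ell\le q-1$, and $s\mid(q-1)/r$. Assume the following uncertainty principle holds for $r$ over $\mathbb{F}_q$: every nonzero $f\in\mathbb{F}_q[X]$ of degree $<r$ satisfies $|f|+|\{x\in\Omega_r: f(x)\neq0\}|\geq r+1$, where $|f|$ is the number of nonzero coefficients of $f$ and $\Omega_r=\{x\in\mathbb{F}_q^*:x^r=1\}$. Then the folded quantum Tamo–Barg code with parameters $q,r,\ell,s$ has distance at least \[ d=\frac{q-1}{s}\left(1-\frac{\ell-1}{q-1}-\epsilon\right),\quad\text{where}\quad \epsilon=\max_{1\leq m\leq r}\min\left\{\left(1-\frac{\ell-1}{q-1}\right)\frac{m-1}{r},\ \frac{1}{m}+\frac{m-1}{s}\right\}. \]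
   Context: $[n]=\{0,\dots,n-1\}$, $\mathbb{F}_q^*=\mathbb{F}_q\setminus\{0\}$. For $S\subseteq\mathbb{Z}_{\ge0}$, $\mathbb{F}_q[X]^S=\{\sum_{i\in S}a_iX^i\}$, $\mathrm{ev}(f)=(f(x))_{x\in\mathbb{F}_q^*}$. Let $S=\{i\in[\ell]:i\not\equiv r-1\pmod r\}\cup\{i\in[q-1]:i\equiv1\pmod r\}$, $C=\mathrm{ev}(\mathbb{F}_q[X]^S)$; for $\ell\ge q/2$, $C^\perp\subseteq C$ and the quantum Tamo–Barg code is $\mathrm{CSS}(C,C)=\mathrm{span}\{\sum_{y\in C^\perp}|x+y\rangle:x\in C\}$, qudits indexed by $\mathbb{F}_q^*$. Folding: fix a generator $\omega$ of $\mathbb{F}_q^*$ and for $i\in[(q-1)/s]$ group the $s$ positions $\{\omega^{si},\dots,\omega^{si+s-1}\}$ into one symbol (alphabet $\mathbb{F}_q^s$, local dimension $q^s$), giving the folded quantum Tamo–Barg code of block length $(q-1)/s$. Its distance is the minimum, over $c\in C\setminus C^\perp$, of the number of blocks $\{\omega^{si},\dots,\omega^{si+s-1}\}$ on which $c$ is not identically zero. *)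

theory Defs
  imports "HOL-Computational_Algebra.Polynomial"
begin

text \<open>Codewords are functions on the field; only the values at nonzero points
  (the qudit positions, indexed by the multiplicative group) matter; we normalise
  them to be 0 at 0.\<close>

definition TB_S :: "nat \<Rightarrow> nat \<Rightarrow> nat \<Rightarrow> nat set" where
  "TB_S q r l = {i. i < l \<and> i mod r \<noteq> r - 1} \<union> {i. i < q - 1 \<and> i mod r = 1}"

definition ev_nz :: "'a::field poly \<Rightarrow> 'a \<Rightarrow> 'a" where
  "ev_nz f = (\<lambda>x. if x = 0 then 0 else poly f x)"

definition TB_code :: "nat \<Rightarrow> nat \<Rightarrow> ('a::{finite,field} \<Rightarrow> 'a) set" where
  "TB_code r l = ev_nz ` {f :: 'a poly. \<forall>i. coeff f i \<noteq> 0 \<longrightarrow> i \<in> TB_S (card (UNIV :: 'a set)) r l}"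

definition dual_code :: "('a::{finite,field} \<Rightarrow> 'a) set \<Rightarrow> ('a \<Rightarrow> 'a) set" where
  "dual_code C = {y. y 0 = 0 \<and> (\<forall>c\<in>C. (\<Sum>x\<in>UNIV - {0}. c x * y x) = 0)}"

definition folded_weight :: "'a::{finite,field} \<Rightarrow> nat \<Rightarrow> ('a \<Rightarrow> 'a) \<Rightarrow> nat" where
  "folded_weight \<omega> s c =
     card {i. i < (card (UNIV :: 'a set) - 1) div s \<and> (\<exists>j<s. c (\<omega> ^ (s * i + j)) \<noteq> 0)}"

text \<open>Distance of the folded quantum Tamo--Barg code CSS(C,C): minimum folded
  weight over \<open>C \ C^\<perp>\<close>.\<close>
definition folded_qTB_distance :: "'a::{finite,field} \<Rightarrow> nat \<Rightarrow> nat \<Rightarrow> nat \<Rightarrow> nat" where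
  "folded_qTB_distance \<omega> r l s =
     (INF c \<in> TB_code r l - dual_code (TB_code r l). folded_weight \<omega> s c)"

definition is_generator :: "'a::{finite,field} \<Rightarrow> bool" where
  "is_generator \<omega> \<longleftrightarrow> \<omega> \<noteq> 0 \<and> (\<forall>x. x \<noteq> 0 \<longrightarrow> (\<exists>k. x = \<omega> ^ k))"

definition TB_eps :: "nat \<Rightarrow> nat \<Rightarrow> nat \<Rightarrow> nat \<Rightarrow> real" where
  "TB_eps q r l s = Max ((\<lambda>m. min ((1 - (real l - 1) / (real q - 1)) * (real m - 1) / real r)
                                   (1 / real m + (real m - 1) / real s)) ` {1..r})"

end

theory Submission
  imports Defs "HOL-Library.FuncSet"
begin

text \<open>Write a codeword as $f = \sum_a f_a$ with $f_a$ collecting the exponents congruent to $a$ modulo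
  $r$; a codeword outside the dual has $f_a \neq 0$ for some $a \neq 1$, and all such $f_a$ have degree
  less than \<open>l\<close>. Let $w \ge 1$ be the number of $a \neq 1$ with $f_a \neq 0$, and take $m = w + 1$
  in \<open>TB_eps\<close>.

  For the first term of the minimum: on each coset of the $r$-th roots of unity $f$ is a polynomial
  of degree less than $r$ with at most $m$ terms, to which the uncertainty principle applies, and
  $f_a$ with $a \neq 1$ is nonzero on at least $q - l$ points.

  For the second term, which needs no uncertainty principle: all the polynomials
  $h_\zeta(X) = \zeta^{-1} (f - f_1)(\zeta X)$ with $\zeta^r = 1$ agree with $- f_1$ on as many blocks
  as $f$ has zero blocks. As in linear-algebraic list decoding of folded Reed-Solomon codes,
  interpolate $A_0, \dots, A_w$ with $A_0(x) = \sum_j A_j(x) f_1(\omega^{j-1} x)$ at the first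
  $s - w + 1$ points of each block. If $f$ had too many zero blocks, then
  $A_0 + \sum_j A_j(X) h_\zeta(\omega^{j-1} X) = 0$ for all $\zeta$, hence $A_0 = 0$ and
  $\sum_j A_j(X) f_a(\omega^{j-1} X) = 0$ for all $a \neq 1$. The top coefficients of the $A_j$ then
  form a nonzero polynomial of degree less than $w$ with the $w$ roots $\omega^{\deg f_a}$.\<close>

section \<open>Root counting and top coefficients of polynomials\<close>

lemma card_roots_less:
  fixes p :: "'a::{comm_ring_1,ring_no_zero_divisors} poly"
  assumes "p \<noteq> 0" "\<forall>i\<ge>d. coeff p i = 0"
  shows "card {x. poly p x = 0} < d"
proof -
  have "degree p < d" using assms leading_coeff_0_iff not_le by blast
  then show ?thesis using card_poly_roots_bound[OF assms(1)] by linarith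
qed

lemma coeff_mult_above_bounds:
  fixes p q :: "'a::comm_semiring_0 poly"
  assumes "\<forall>i>m. coeff p i = 0" "\<forall>i>n. coeff q i = 0" "i > m + n"
  shows "coeff (p * q) i = 0"
proof -
  have "degree p \<le> m" "degree q \<le> n" using assms by (auto intro: degree_le)
  then show ?thesis using degree_mult_le[of p q] assms(3) by (intro coeff_eq_0) linarith
qed

text \<open>The bounds need not be attained. This allows one common bound for a whole family of
  polynomials, some of whose coefficients at the bound may vanish.\<close>

lemma coeff_mult_at_bounds:
  fixes p q :: "'a::comm_semiring_0 poly"
  assumes "\<forall>i>m. coeff p i = 0" "\<forall>i>n. coeff q i = 0"
  shows "coeff (p * q) (m + n) = coeff p m * coeff q n"
proof -
  have "coeff (p * q) (m + n) = (\<Sum>i\<le>m + n. coeff p i * coeff q (m + n - i))"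
    by (rule coeff_mult)
  also have "\<dots> = (\<Sum>i\<in>{m}. coeff p i * coeff q (m + n - i))"
  proof (rule sum.mono_neutral_right)
    show "\<forall>i\<in>{..m + n} - {m}. coeff p i * coeff q (m + n - i) = 0"
    proof
      fix i assume "i \<in> {..m + n} - {m}"
      then have "i > m \<or> m + n - i > n" by auto
      then show "coeff p i * coeff q (m + n - i) = 0" using assms by auto
    qed
  qed auto
  finally show ?thesis by simp
qed

text \<open>If some \<open>A j\<close> were nonzero, let \<open>K\<close> be the largest degree
  among them. The coefficient of degree \<open>K + degree (F a)\<close> in the relation for
  \<open>a\<close> says that the polynomial with coefficients \<open>coeff (A j) K\<close> has the
  root \<open>\<omega> ^ degree (F a)\<close>. This gives at least \<open>w\<close> distinct roots
  of a nonzero polynomial of degree less than \<open>w\<close>.\<close>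

lemma sum_dilations_eq_0:
  fixes A :: "nat \<Rightarrow> 'a::{field} poly" and F :: "'b \<Rightarrow> 'a poly"
  assumes I: "finite I" "card I \<ge> w"
    and nz: "\<And>a. a \<in> I \<Longrightarrow> F a \<noteq> 0"
    and inj: "inj_on (\<lambda>a. \<omega> ^ degree (F a)) I"
    and eq: "\<And>a. a \<in> I \<Longrightarrow> (\<Sum>j<w. A j * pcompose (F a) [:0, \<omega> ^ j:]) = 0"
    and j: "j < w"
  shows "A j = 0"
proof (rule ccontr)
  assume Aj: "A j \<noteq> 0"
  define K where "K = Max ((\<lambda>j. degree (A j)) ` {j. j < w \<and> A j \<noteq> 0})"
  have fin: "finite {j. j < w \<and> A j \<noteq> 0}" by simp
  have K_ge: "degree (A i) \<le> K" if "i < w" "A i \<noteq> 0" for i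
    unfolding K_def using that fin by (intro Max_ge) auto
  have K_above: "\<forall>k>K. coeff (A i) k = 0" if "i < w" for i
    using K_ge[OF that] by (cases "A i = 0") (auto intro: coeff_eq_0)
  have "K \<in> (\<lambda>j. degree (A j)) ` {j. j < w \<and> A j \<noteq> 0}"
    unfolding K_def using fin Aj j by (intro Max_in) auto
  then obtain k where k: "k < w" "A k \<noteq> 0" "degree (A k) = K" by auto
  define B where "B = (\<Sum>i<w. monom (coeff (A i) K) i)"
  have coeff_B: "coeff B i = (if i < w then coeff (A i) K else 0)" for i
    by (simp add: B_def coeff_sum coeff_monom)
  have "B \<noteq> 0"
  proof
    assume "B = 0"
    then have "coeff (A k) K = 0" using coeff_B[of k] k(1) by simp
    then show False using k by (metis leading_coeff_0_iff)
  qed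
  have root: "poly B (\<omega> ^ degree (F a)) = 0" if a: "a \<in> I" for a
  proof -
    let ?d = "degree (F a)"
    have "0 = (\<Sum>i<w. coeff (A i * pcompose (F a) [:0, \<omega> ^ i:]) (K + ?d))"
      using arg_cong[OF eq[OF a], of "\<lambda>p. coeff p (K + ?d)"] by (simp add: coeff_sum)
    \<comment> \<open>Dilation by \<open>\<omega> ^ i\<close> multiplies the leading coefficient of
      \<open>F a\<close> by \<open>(\<omega> ^ i) ^ ?d\<close>, which equals
      \<open>(\<omega> ^ ?d) ^ i\<close>. Hence the sum is an evaluation of
      \<open>B\<close>.\<close>
    also have "\<dots> = (\<Sum>i<w. coeff (A i) K * ((\<omega> ^ i) ^ ?d * coeff (F a) ?d))"
      using K_above
      by (intro sum.cong refl, subst coeff_mult_at_bounds)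
         (auto simp: coeff_pcompose_linear coeff_eq_0)
    also have "\<dots> = coeff (F a) ?d * (\<Sum>i<w. coeff (A i) K * (\<omega> ^ ?d) ^ i)"
      by (simp add: sum_distrib_left mult_ac flip: power_mult)
    also have "(\<Sum>i<w. coeff (A i) K * (\<omega> ^ ?d) ^ i) = poly B (\<omega> ^ ?d)"
      by (simp add: B_def poly_sum poly_monom)
    finally show ?thesis using nz[OF a] by simp
  qed
  have "w \<le> card ((\<lambda>a. \<omega> ^ degree (F a)) ` I)" using inj I(2) by (simp add: card_image)
  also have "\<dots> \<le> card {x. poly B x = 0}"
    using root \<open>B \<noteq> 0\<close> by (intro card_mono) (auto intro: poly_roots_finite)
  also have "\<dots> < w" using \<open>B \<noteq> 0\<close> coeff_B by (intro card_roots_less) auto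
  finally show False by simp
qed

section \<open>Interpolation and Vandermonde arguments\<close>

text \<open>Over a finite field the solution of an underdetermined homogeneous system comes from the
  pigeonhole principle.\<close>

lemma underdetermined_homogeneous_system:
  fixes M :: "'e \<Rightarrow> 'i \<Rightarrow> 'a::{finite,field}"
  assumes "finite I" "finite E" "card E < card I"
  obtains u where "\<And>e. e \<in> E \<Longrightarrow> (\<Sum>i\<in>I. u i * M e i) = 0" "\<exists>i\<in>I. u i \<noteq> 0"
proof -
  let ?U = "I \<rightarrow>\<^sub>E (UNIV :: 'a set)" and ?V = "E \<rightarrow>\<^sub>E (UNIV :: 'a set)"
  define \<phi> where "\<phi> u = restrict (\<lambda>e. \<Sum>i\<in>I. u i * M e i) E" for u
  have "card {0, 1 :: 'a} \<le> card (UNIV :: 'a set)" by (intro card_mono) auto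
  then have "card (UNIV :: 'a set) > 1" by simp
  then have "card ?V < card ?U"
    using assms by (simp add: card_funcsetE power_strict_increasing)
  moreover have "\<phi> ` ?U \<subseteq> ?V" by (auto simp: \<phi>_def)
  ultimately have "\<not> inj_on \<phi> ?U"
    using card_inj_on_le[of \<phi> ?U ?V] assms by (auto simp: finite_PiE)
  then obtain u v where uv: "u \<in> ?U" "v \<in> ?U" "\<phi> u = \<phi> v" "u \<noteq> v" by (auto simp: inj_on_def)
  have "(\<Sum>i\<in>I. (u i - v i) * M e i) = 0" if "e \<in> E" for e
    using fun_cong[OF uv(3), of e] that by (simp add: \<phi>_def left_diff_distrib sum_subtractf)
  moreover have "\<exists>i\<in>I. u i - v i \<noteq> 0"
    using uv(1,2,4) PiE_ext by (metis right_minus_eq)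
  ultimately show ?thesis by (rule that)
qed

text \<open>The unknowns are the coefficients of the \<open>A j\<close>, with \<open>d j\<close> of
  them for each \<open>j\<close>, and every point of \<open>E\<close> imposes one homogeneous linear
  equation. There are more unknowns than equations.\<close>

lemma polynomial_interpolation:
  fixes \<phi> :: "'j \<Rightarrow> 'a::{finite,field} \<Rightarrow> 'a"
  assumes "finite J" "card E < (\<Sum>j\<in>J. d j)"
  obtains A where "\<And>x. x \<in> E \<Longrightarrow> (\<Sum>j\<in>J. poly (A j) x * \<phi> j x) = 0"
    "\<And>j. \<forall>i\<ge>d j. coeff (A j) i = 0" "\<exists>j\<in>J. A j \<noteq> 0"
proof -
  let ?I = "Sigma J (\<lambda>j. {..<d j})"
  have "card E < card ?I" using assms by simp
  then obtain u where u: "\<And>x. x \<in> E \<Longrightarrow> (\<Sum>p\<in>?I. u p * (case p of (j, i) \<Rightarrow> x ^ i * \<phi> j x)) = 0"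
      "\<exists>p\<in>?I. u p \<noteq> 0"
    using underdetermined_homogeneous_system[of ?I E "\<lambda>x. \<lambda>(j, i). x ^ i * \<phi> j x"] assms(1)
    by auto
  define A where "A j = (\<Sum>i<d j. monom (u (j, i)) i)" for j
  have coeff_A: "coeff (A j) i = (if i < d j then u (j, i) else 0)" for i j
    by (simp add: A_def coeff_sum coeff_monom)
  show ?thesis
  proof (rule that[of A])
    fix x assume "x \<in> E"
    have "(\<Sum>j\<in>J. poly (A j) x * \<phi> j x) = (\<Sum>j\<in>J. \<Sum>i<d j. u (j, i) * (x ^ i * \<phi> j x))"
      by (simp add: A_def poly_sum poly_monom sum_distrib_left mult_ac)
    also have "\<dots> = 0"
      using u(1)[OF \<open>x \<in> E\<close>] assms(1) by (subst sum.Sigma) (auto simp: case_prod_unfold)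
    finally show "(\<Sum>j\<in>J. poly (A j) x * \<phi> j x) = 0" .
  next
    from u(2) obtain j i where "j \<in> J" "i < d j" "u (j, i) \<noteq> 0" by auto
    then have "coeff (A j) i \<noteq> 0" by (simp add: coeff_A)
    then show "\<exists>j\<in>J. A j \<noteq> 0" using \<open>j \<in> J\<close> coeff_0 by metis
  qed (use coeff_A in auto)
qed

text \<open>A Vandermonde argument for each coefficient: for fixed \<open>k\<close>, the numbers
  \<open>coeff (F a) k\<close> are the coefficients of a polynomial of degree less than
  \<open>r\<close> that vanishes on the at least \<open>r\<close> points of
  \<open>Z\<close>.\<close>

lemma sum_smult_powers_eq_0:
  fixes F :: "nat \<Rightarrow> 'a::field poly"
  assumes "card Z \<ge> r" "finite Z"
    and eq: "\<And>z. z \<in> Z \<Longrightarrow> (\<Sum>a<r. smult (z ^ a) (F a)) = 0"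
    and "a < r"
  shows "F a = 0"
proof (rule poly_eqI)
  fix k
  define B where "B = (\<Sum>a<r. monom (coeff (F a) k) a)"
  have coeff_B: "coeff B i = (if i < r then coeff (F i) k else 0)" for i
    by (simp add: B_def coeff_sum coeff_monom)
  have "Z \<subseteq> {x. poly B x = 0}"
  proof
    fix z assume "z \<in> Z"
    from arg_cong[OF eq[OF this], of "\<lambda>p. coeff p k"] show "z \<in> {x. poly B x = 0}"
      by (simp add: B_def poly_sum poly_monom coeff_sum mult_ac)
  qed
  then have "r \<le> card {x. poly B x = 0}" if "B \<noteq> 0"
    using assms(1) card_mono[OF poly_roots_finite[OF that]] by (meson order_trans)
  moreover have "card {x. poly B x = 0} < r" if "B \<noteq> 0"
    using that coeff_B by (intro card_roots_less) auto
  ultimately have "B = 0" by fastforce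
  then show "coeff (F a) k = coeff 0 k" using coeff_B[of a] \<open>a < r\<close> by simp
qed

section \<open>Splitting a polynomial by its exponents modulo \<open>r\<close>\<close>

definition residue_part :: "nat \<Rightarrow> nat \<Rightarrow> 'a::comm_semiring_1 poly \<Rightarrow> 'a poly" where
  "residue_part r a f = (\<Sum>i\<le>degree f. monom (if i mod r = a then coeff f i else 0) i)"

lemma coeff_residue_part: "coeff (residue_part r a f) i = (if i mod r = a then coeff f i else 0)"
  by (auto simp: residue_part_def coeff_sum coeff_monom coeff_eq_0)

lemma sum_residue_part:
  assumes "r > 0" shows "(\<Sum>a<r. residue_part r a f) = f"
  by (rule poly_eqI) (simp add: coeff_sum coeff_residue_part assms sum.delta')

text \<open>Since \<open>z ^ i\<close> depends only on \<open>i mod r\<close>, all monomials of the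
  part scale alike. So on a coset of the \<open>r\<close>-th roots of unity, \<open>f\<close>
  becomes a polynomial in \<open>z\<close> of degree less than \<open>r\<close>.\<close>

lemma poly_residue_part_mult:
  fixes z :: "'a::comm_semiring_1"
  assumes "z ^ r = 1"
  shows "poly (residue_part r a f) (z * x) = z ^ a * poly (residue_part r a f) x"
proof -
  have "z ^ i = z ^ (i mod r)" for i
    by (metis assms div_mult_mod_eq mult.commute mult_1 power_add power_mult power_one)
  then show ?thesis
    by (auto simp: residue_part_def poly_sum poly_monom power_mult_distrib sum_distrib_left
        mult_ac intro!: sum.cong)
qed

lemma smult_sum_right: "smult c (sum f A) = (\<Sum>a\<in>A. smult c (f a))"
  by (induction A rule: infinite_finite_induct) (simp_all add: smult_add_right)

section \<open>The multiplicative group of a finite field\<close>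

locale field_generator =
  fixes \<omega> :: "'a::{finite,field}" and n :: nat
  assumes gen: "is_generator \<omega>" and n_eq: "n = card (UNIV :: 'a set) - 1"
begin

lemma generator_nonzero [simp]: "\<omega> \<noteq> 0"
  using gen by (simp add: is_generator_def)

lemma card_nonzero: "card (UNIV - {0 :: 'a}) = n"
  by (simp add: n_eq card_Diff_singleton)

lemma n_pos: "n > 0"
proof -
  have "UNIV - {0 :: 'a} \<noteq> {}" using one_neq_zero by blast
  then show ?thesis unfolding card_nonzero[symmetric] card_gt_0_iff by simp
qed

text \<open>The powers of \<open>\<omega>\<close> below its order \<open>d\<close> are distinct, and
  they exhaust the nonzero elements because \<open>\<omega>\<close> is a generator. Counting gives
  \<open>d = n\<close>.\<close>

lemma power_n: "\<omega> ^ n = 1" and inj_power: "inj_on (\<lambda>k. \<omega> ^ k) {..<n}"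
proof -
  have "\<not> inj (\<lambda>k. \<omega> ^ k)" using finite_imageD[of "\<lambda>k. \<omega> ^ k" "UNIV :: nat set"] by auto
  then obtain i j :: nat where "\<omega> ^ i = \<omega> ^ j" "i < j"
    unfolding inj_on_def by (metis linorder_neqE_nat)
  then have ex: "0 < j - i \<and> \<omega> ^ (j - i) = 1"
    by (simp add: power_diff)
  define d where "d = (LEAST d. 0 < d \<and> \<omega> ^ d = 1)"
  have d: "d > 0" "\<omega> ^ d = 1"
    using LeastI[of "\<lambda>d. 0 < d \<and> \<omega> ^ d = 1", OF ex] by (auto simp: d_def)
  have d_min: "\<not> (0 < k \<and> \<omega> ^ k = 1)" if "k < d" for k
    using that not_less_Least unfolding d_def by blast
  have inj: "inj_on (\<lambda>k. \<omega> ^ k) {..<d}"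
  proof (rule linorder_inj_onI')
    fix i j assume ij: "i \<in> {..<d}" "j \<in> {..<d}" "i < j"
    show "\<omega> ^ i \<noteq> \<omega> ^ j"
    proof
      assume "\<omega> ^ i = \<omega> ^ j"
      then have "0 < j - i \<and> \<omega> ^ (j - i) = 1" using ij by (simp add: power_diff)
      then moreover have "j - i < d" using ij by auto
      ultimately show False using d_min by blast
    qed
  qed
  have "UNIV - {0} \<subseteq> (\<lambda>k. \<omega> ^ k) ` {..<d}"
  proof
    fix x :: 'a assume "x \<in> UNIV - {0}"
    then obtain k where "x = \<omega> ^ k" using gen unfolding is_generator_def by blast
    moreover have "\<omega> ^ k = \<omega> ^ (k mod d)"
      by (metis d(2) div_mult_mod_eq mult.commute mult_1 power_add power_mult power_one)
    ultimately show "x \<in> (\<lambda>k. \<omega> ^ k) ` {..<d}" using d by auto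
  qed
  then have "(\<lambda>k. \<omega> ^ k) ` {..<d} = UNIV - {0}" by auto
  then have "d = n" using card_image[OF inj] card_nonzero by simp
  then show "\<omega> ^ n = 1" "inj_on (\<lambda>k. \<omega> ^ k) {..<n}" using d inj by auto
qed

lemma generator_power_mod: "\<omega> ^ (k mod n) = \<omega> ^ k"
  by (metis power_n div_mult_mod_eq mult.commute mult_1 power_add power_mult power_one)

lemma generator_power_eq_iff: "\<omega> ^ i = \<omega> ^ j \<longleftrightarrow> i mod n = j mod n"
proof
  assume "\<omega> ^ i = \<omega> ^ j"
  then have "\<omega> ^ (i mod n) = \<omega> ^ (j mod n)" by (simp add: generator_power_mod)
  then show "i mod n = j mod n" using inj_power n_pos by (auto dest: inj_onD)
next
  assume "i mod n = j mod n"
  then show "\<omega> ^ i = \<omega> ^ j" by (metis generator_power_mod)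
qed

lemma generator_power_eq_1_iff: "\<omega> ^ k = 1 \<longleftrightarrow> n dvd k"
  using generator_power_eq_iff[of k 0] by (auto simp: dvd_eq_mod_eq_0)

lemma nonzero_elements: "UNIV - {0} = (\<lambda>k. \<omega> ^ k) ` {..<n}"
  using card_image[OF inj_power] card_nonzero
  by (intro card_subset_eq[symmetric]) auto

text \<open>Multiplication by \<open>\<omega>\<close> permutes the nonzero elements, so the sum
  equals \<open>\<omega> ^ k\<close> times itself, where \<open>\<omega> ^ k\<close> is not
  1.\<close>

lemma sum_power_eq_0:
  assumes "\<not> n dvd k"
  shows "(\<Sum>x\<in>UNIV - {0 :: 'a}. x ^ k) = 0"
proof -
  let ?S = "\<Sum>x\<in>UNIV - {0 :: 'a}. x ^ k"
  have "?S = (\<Sum>x\<in>UNIV - {0 :: 'a}. (\<omega> * x) ^ k)"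
    by (rule sum.reindex_bij_witness[of _ "\<lambda>x. \<omega> * x" "\<lambda>x. x / \<omega>"]) auto
  also have "\<dots> = \<omega> ^ k * ?S" by (simp add: power_mult_distrib sum_distrib_left)
  finally have "(\<omega> ^ k - 1) * ?S = 0" by (simp add: algebra_simps)
  then show ?thesis using assms by (simp add: generator_power_eq_1_iff)
qed

text \<open>The explicit exponents are what later makes multiplication by a root of unity a shift of
  blocks, as \<open>s\<close> divides \<open>n div r\<close>.\<close>

lemma root_of_unity_iff:
  assumes "r dvd n"
  shows "z ^ r = 1 \<longleftrightarrow> (\<exists>k<r. z = \<omega> ^ (n div r * k))"
proof
  have r: "r > 0" using assms n_pos by (auto intro: Nat.gr0I)
  assume z: "z ^ r = 1"
  then have "z \<in> UNIV - {0}" using r by (auto simp: power_0_left)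
  then obtain e where e: "e < n" "z = \<omega> ^ e" unfolding nonzero_elements by auto
  then have "n dvd e * r" using z by (simp add: generator_power_eq_1_iff flip: power_mult)
  then have "n div r * r dvd e * r" using assms by simp
  then have "n div r dvd e" using r by (simp only: dvd_times_right_cancel_iff)
  then obtain k where k: "e = n div r * k" by blast
  then have "n div r * k < n div r * r" using e assms by simp
  then show "\<exists>k<r. z = \<omega> ^ (n div r * k)" using e k by auto
next
  assume "\<exists>k<r. z = \<omega> ^ (n div r * k)"
  then obtain k where "z = \<omega> ^ (n div r * k)" by blast
  then have "z ^ r = (\<omega> ^ n) ^ k" using assms
    by (metis dvd_div_mult_self mult.assoc mult.commute power_mult)
  then show "z ^ r = 1" by (simp add: power_n)
qed

lemma card_roots_of_unity:
  assumes "r dvd n"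
  shows "card {z :: 'a. z ^ r = 1} = r"
proof -
  have r: "r > 0" using assms n_pos by (auto intro: Nat.gr0I)
  have pos: "n div r > 0" using assms n_pos by (auto simp: dvd_imp_le r div_greater_zero_iff)
  have "{z :: 'a. z ^ r = 1} = (\<lambda>k. \<omega> ^ (n div r * k)) ` {..<r}"
    using root_of_unity_iff[OF assms] by auto
  moreover have "inj_on (\<lambda>k. \<omega> ^ (n div r * k)) {..<r}"
  proof (rule inj_onI)
    fix i j assume ij: "i \<in> {..<r}" "j \<in> {..<r}" "\<omega> ^ (n div r * i) = \<omega> ^ (n div r * j)"
    have "n div r * k < n" if "k \<in> {..<r}" for k
    proof -
      have "n div r * k < n div r * r" using that pos by simp
      then show ?thesis using assms by simp
    qed
    with ij have "n div r * i = n div r * j" by (simp add: generator_power_eq_iff)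
    then show "i = j" using pos by simp
  qed
  ultimately show ?thesis by (simp add: card_image)
qed

section \<open>The two weight bounds\<close>

lemma card_nonroots_ge:
  fixes g :: "'a poly"
  assumes "g \<noteq> 0" "\<forall>i\<ge>l. coeff g i = 0"
  shows "n + 1 - l \<le> card {x. x \<noteq> 0 \<and> poly g x \<noteq> 0}"
proof -
  have "n = card ({x. x \<noteq> 0 \<and> poly g x \<noteq> 0} \<union> {x. x \<noteq> 0 \<and> poly g x = 0})"
    unfolding card_nonzero[symmetric] by (rule arg_cong[of _ _ card]) auto
  also have "\<dots> \<le> card {x. x \<noteq> 0 \<and> poly g x \<noteq> 0} + card {x. x \<noteq> 0 \<and> poly g x = 0}"
    by (rule card_Un_le)
  also have "card {x. x \<noteq> 0 \<and> poly g x = 0} \<le> card {x. poly g x = 0}"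
    by (intro card_mono) auto
  finally show ?thesis using card_roots_less[OF assms] by linarith
qed

text \<open>Double counting of pairs \<open>(b, x)\<close> with \<open>b\<close> a nonzero nonroot
  of the part at \<open>e\<close>, \<open>x ^ r = 1\<close> and \<open>f\<close> nonzero at
  \<open>x * b\<close>. Each of the at least \<open>n + 1 - l\<close> choices of \<open>b\<close>
  has at least \<open>r + 1 - m\<close> partners by the uncertainty principle, and each point of the
  support of \<open>f\<close> comes from at most \<open>r\<close> pairs.\<close>

lemma uncertainty_weight_bound:
  fixes f :: "'a poly"
  assumes r: "r dvd n"
    and uncertainty: "\<And>f :: 'a poly. f \<noteq> 0 \<Longrightarrow> degree f < r \<Longrightarrow>
        card {i. coeff f i \<noteq> 0} + card {x. x \<noteq> 0 \<and> x ^ r = 1 \<and> poly f x \<noteq> 0} \<ge> r + 1"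
    and m: "card {a. a < r \<and> residue_part r a f \<noteq> 0} \<le> m"
    and e: "e < r" "residue_part r e f \<noteq> 0" "\<forall>i\<ge>l. coeff (residue_part r e f) i = 0"
  shows "(n + 1 - l) * (r + 1 - m) \<le> r * card {x. x \<noteq> 0 \<and> poly f x \<noteq> 0}"
proof -
  let ?g = "residue_part r e f"
  let ?U = "{x. x \<noteq> 0 \<and> poly ?g x \<noteq> 0}"
  let ?V = "\<lambda>b. {x. x \<noteq> 0 \<and> x ^ r = 1 \<and> poly f (x * b) \<noteq> 0}"
  let ?W = "{x. x \<noteq> 0 \<and> poly f x \<noteq> 0}"
  have V: "r + 1 - m \<le> card (?V b)" if "b \<in> ?U" for b
  proof -
    \<comment> \<open>\<open>p\<close> is \<open>f\<close> restricted to the coset of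
      \<open>b\<close>: it takes the value of \<open>f\<close> at \<open>x * b\<close> whenever
      \<open>x ^ r = 1\<close>. Its coefficient at \<open>e\<close> is nonzero by the choice of
      \<open>b\<close>.\<close>
    define p where "p = (\<Sum>a<r. monom (poly (residue_part r a f) b) a)"
    have coeff_p: "coeff p i = (if i < r then poly (residue_part r i f) b else 0)" for i
      by (simp add: p_def coeff_sum coeff_monom)
    have "p \<noteq> 0" using coeff_p[of e] that e(1) by auto
    moreover have "degree p < r"
      using \<open>p \<noteq> 0\<close> coeff_p by (metis leading_coeff_0_iff)
    ultimately have "r + 1 \<le> card {i. coeff p i \<noteq> 0} + card {x. x \<noteq> 0 \<and> x ^ r = 1 \<and> poly p x \<noteq> 0}"
      by (rule uncertainty)
    moreover have "card {i. coeff p i \<noteq> 0} \<le> card {a. a < r \<and> residue_part r a f \<noteq> 0}"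
      by (intro card_mono) (auto simp: coeff_p split: if_splits)
    moreover have "poly p x = poly f (x * b)" if "x ^ r = 1" for x
    proof -
      have "poly f (x * b) = poly (\<Sum>a<r. residue_part r a f) (x * b)"
        using e(1) by (simp add: sum_residue_part)
      also have "\<dots> = poly p x"
        by (simp add: p_def poly_sum poly_monom poly_residue_part_mult[OF that])
           (simp add: mult.commute)
      finally show ?thesis ..
    qed
    then have "{x. x \<noteq> 0 \<and> x ^ r = 1 \<and> poly p x \<noteq> 0} = ?V b" by auto
    then have "card {x. x \<noteq> 0 \<and> x ^ r = 1 \<and> poly p x \<noteq> 0} = card (?V b)" by (rule arg_cong)
    ultimately show ?thesis using m by linarith
  qed
  have "(n + 1 - l) * (r + 1 - m) \<le> card ?U * (r + 1 - m)"
    using card_nonroots_ge[OF e(2,3)] by (rule mult_le_mono1)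
  also have "\<dots> \<le> (\<Sum>b\<in>?U. card (?V b))"
    using sum_bounded_below[of ?U "r + 1 - m" "\<lambda>b. card (?V b)"] V by simp
  also have "\<dots> = card (Sigma ?U ?V)" by (subst card_SigmaI) auto
  also have "\<dots> \<le> card ({x :: 'a. x ^ r = 1} \<times> ?W)"
  proof (rule card_inj_on_le)
    \<comment> \<open>The first component \<open>x\<close> is nonzero, so \<open>b\<close> is
      recovered by division.\<close>
    show "inj_on (\<lambda>(b, x). (x, x * b)) (Sigma ?U ?V)" by (auto simp: inj_on_def)
  qed auto
  finally show ?thesis by (simp add: card_cartesian_product card_roots_of_unity[OF r])
qed

text \<open>The interpolation argument for the second term of the minimum, with \<open>z\<close> the
  number of zero blocks. Subtraction truncates, so the claim is trivial unless
  \<open>z * (s + 1 - w)\<close> exceeds \<open>l - 1\<close>. A violation supplies more unknown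
  coefficients than interpolation conditions.\<close>

lemma folded_vanishing_bound:
  fixes f :: "'a poly"
  assumes r: "r dvd n" and s: "s dvd n div r" and l: "1 \<le> l" "l \<le> n" and e: "e < r"
    and low: "\<And>i. i \<ge> l \<Longrightarrow> i mod r \<noteq> e \<Longrightarrow> coeff f i = 0"
    and w: "card {a. a < r \<and> a \<noteq> e \<and> residue_part r a f \<noteq> 0} = w" "0 < w" "w \<le> s"
    and z: "card {i. i < n div s \<and> (\<forall>j<s. poly f (\<omega> ^ (s * i + j)) = 0)} = z"
  shows "(z * (s + 1 - w) - (l - 1)) * (w + 1) \<le> n div s * (s + 1 - w)"
proof (rule ccontr)
  assume contra: "\<not> ?thesis"
  let ?I = "{a. a < r \<and> a \<noteq> e \<and> residue_part r a f \<noteq> 0}"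
  let ?Z = "{i. i < n div s \<and> (\<forall>j<s. poly f (\<omega> ^ (s * i + j)) = 0)}"
  \<comment> \<open>\<open>N\<close> is the number of blocks. \<open>T\<close> counts the offsets
    \<open>t\<close> for which \<open>t, ..., t + w - 1\<close> all stay inside a block.
    \<open>D\<close> bounds the number of coefficients of each \<open>A (Suc j)\<close>.\<close>
  define N where "N = n div s"
  define T where "T = s + 1 - w"
  define D where "D = z * T - (l - 1)"
  have D: "N * T < D * (w + 1)" using contra unfolding N_def T_def D_def by (rule not_le_imp_less)
  then have "D > 0" by (cases D) auto
  then have zT: "z * T = D + (l - 1)" by (simp add: D_def)
  have "n div r dvd n" using dvd_triv_left[of "n div r" r] r by simp
  with s have "s dvd n" by (rule dvd_trans)
  then have Ns: "N * s = n" by (simp add: N_def)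
  then have s_pos: "s > 0" and N_pos: "N > 0" using n_pos by (auto intro: Nat.gr0I)
  define pt where "pt = (\<lambda>(i, t). \<omega> ^ (s * i + t))"
  have T_le: "T + w \<le> s + 1" "T \<le> s" "T > 0" using w(2,3) by (auto simp: T_def)
  have inj_pt: "inj_on pt ({..<N} \<times> {..<s})"
  proof (rule inj_onI, safe)
    fix i t i' t'
    assume A: "i < N" "t < s" "i' < N" "t' < s" "pt (i, t) = pt (i', t')"
    have "s * i + t < n" if "i < N" "t < s" for i t
    proof -
      have "s * i + t < s * Suc i" using that by simp
      also have "\<dots> \<le> s * N" using that by (intro mult_le_mono) auto
      finally show ?thesis using Ns by (simp add: mult.commute)
    qed
    with A have eq: "s * i + t = s * i' + t'" by (simp add: pt_def generator_power_eq_iff)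
    from arg_cong[OF eq, of "\<lambda>x. x div s"] arg_cong[OF eq, of "\<lambda>x. x mod s"] A s_pos
    show "i = i'" "t = t'" by simp_all
  qed
  \<comment> \<open>The degree bounds are balanced: a product of \<open>A (Suc j)\<close> with a
    polynomial of degree at most \<open>l - 1\<close> has degree below
    \<open>D + (l - 1) = z * T\<close>, the bound chosen for \<open>A 0\<close>. There are at least
    \<open>D * (w + 1)\<close> unknowns in total, against at most \<open>N * T\<close>
    conditions.\<close>
  define E where "E = pt ` ({..<N} \<times> {..<T})"
  define d where "d = (\<lambda>j::nat. if j = 0 then z * T else D)"
  define \<phi> where "\<phi> = (\<lambda>j x. case j of 0 \<Rightarrow> 1 | Suc j \<Rightarrow> - poly (residue_part r e f) (\<omega> ^ j * x))"
  have "card E \<le> N * T"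
    unfolding E_def using card_image_le[of "{..<N} \<times> {..<T}" pt] by (simp add: card_cartesian_product)
  also note D
  also have "D * (w + 1) \<le> (\<Sum>j\<le>w. d j)" by (simp add: d_def sum.atMost_shift zT)
  finally obtain A where A: "\<And>x. x \<in> E \<Longrightarrow> (\<Sum>j\<le>w. poly (A j) x * \<phi> j x) = 0"
    "\<And>j. \<forall>i\<ge>d j. coeff (A j) i = 0" "\<exists>j\<in>{..w}. A j \<noteq> 0"
    using polynomial_interpolation[of "{..w}" E d \<phi>] by auto
  have A_E: "poly (A 0) x = (\<Sum>j<w. poly (A (Suc j)) x * poly (residue_part r e f) (\<omega> ^ j * x))"
    if "x \<in> E" for x
    using A(1)[OF that] by (simp add: sum.atMost_shift \<phi>_def sum_negf)
  define h where "h = (\<Sum>a\<in>{..<r} - {e}. residue_part r a f)"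
  have f_eq: "f = residue_part r e f + h"
  proof -
    have "f = (\<Sum>a<r. residue_part r a f)" using e by (simp add: sum_residue_part)
    also have "\<dots> = residue_part r e f + h"
      unfolding h_def using e by (intro sum.remove) auto
    finally show ?thesis .
  qed
  have poly_f: "poly f x = poly (residue_part r e f) x + poly h x" for x
    using arg_cong[OF f_eq, of "\<lambda>p. poly p x"] by simp
  have coeff_h: "coeff h i = (if i mod r = e then 0 else coeff f i)" for i
    using arg_cong[OF f_eq, of "\<lambda>p. coeff p i"] by (auto simp: coeff_residue_part split: if_splits)
  \<comment> \<open>\<open>F a\<close> is the coefficient of \<open>u ^ a\<close> when the
    polynomial \<open>R\<close> below is expanded over the residue classes.\<close>
  define F where "F = (\<lambda>a. if a = e then A 0
    else \<Sum>j<w. A (Suc j) * pcompose (residue_part r a f) [:0, \<omega> ^ j:])"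
  have F_comb: "(\<Sum>a<r. smult (u ^ a) (F a)) = 0" if u: "u ^ r = 1" for u
  proof -
    \<comment> \<open>With \<open>e = 1\<close> this is \<open>u\<close> times the polynomial
      \<open>A_0 + \<Sum>_j A_j(X) h_u(\<omega>^(j-1) X)\<close> of the overview. It vanishes
      because it has \<open>z * T\<close> roots and degree less than \<open>z * T\<close>.\<close>
    define R where "R = smult (u ^ e) (A 0) + (\<Sum>j<w. A (Suc j) * pcompose h [:0, u * \<omega> ^ j:])"
    have "u \<noteq> 0" using u e by (auto simp: power_0_left)
    have root: "poly R (y / u) = 0" if y: "y \<in> pt ` (?Z \<times> {..<T})" for y
    proof -
      obtain i t where it: "i < N" "t < T" "y = \<omega> ^ (s * i + t)"
        "\<forall>j<s. poly f (\<omega> ^ (s * i + j)) = 0"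
        using y by (auto simp: pt_def N_def)
      \<comment> \<open>\<open>1 / u\<close> is a power of \<open>\<omega>\<close> with exponent
        divisible by \<open>s\<close>. Hence division by \<open>u\<close> moves whole blocks
        cyclically and keeps the offset \<open>t\<close>, so the interpolation condition is
        available at \<open>y / u\<close>.\<close>
      have "(1 / u) ^ r = 1" using u by (simp add: power_divide)
      then obtain k where "1 / u = \<omega> ^ (n div r * k)" using root_of_unity_iff[OF r] by blast
      moreover from s obtain c where "n div r = s * c" by (rule dvdE)
      ultimately obtain k where k: "1 / u = \<omega> ^ (s * k)" by (auto simp: mult.assoc)
      have "y / u = \<omega> ^ (s * i + t) * (1 / u)" by (simp add: it)
      also have "\<dots> = \<omega> ^ (s * ((i + k) mod N) + t)"
      proof -
        have "s * ((i + k) mod N) = s * (i + k) mod (s * N)" by (rule mult_mod_right)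
        then have "\<omega> ^ (s * (i + k)) = \<omega> ^ (s * ((i + k) mod N))"
          using Ns by (simp only: mult.commute[of s N] generator_power_mod)
        then show ?thesis by (simp add: k power_add algebra_simps)
      qed
      finally have "y / u \<in> E" using it N_pos by (auto simp: E_def pt_def)
      then have "poly R (y / u) = (\<Sum>j<w. u ^ e *
          (poly (A (Suc j)) (y / u) * poly (residue_part r e f) (\<omega> ^ j * (y / u)))) +
          (\<Sum>j<w. poly (A (Suc j)) (y / u) * poly h (y / u * (u * \<omega> ^ j)))"
        by (simp add: R_def poly_sum poly_pcompose A_E sum_distrib_left)
      also have "\<dots> = (\<Sum>j<w. poly (A (Suc j)) (y / u) *
          (u ^ e * poly (residue_part r e f) (\<omega> ^ j * (y / u)) + poly h (\<omega> ^ j * y)))"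
        using \<open>u \<noteq> 0\<close> by (simp add: algebra_simps flip: sum.distrib)
      \<comment> \<open>The factor \<open>u ^ e\<close> turns the part at \<open>e\<close> evaluated
        at \<open>\<omega> ^ j * (y / u)\<close> into its value at \<open>\<omega> ^ j * y\<close>,
        where it combines with \<open>h\<close> to \<open>f\<close>. These points lie in the zero
        block of \<open>y\<close>.\<close>
      also have "\<dots> = (\<Sum>j<w. poly (A (Suc j)) (y / u) * poly f (\<omega> ^ j * y))"
      proof (rule sum.cong[OF refl])
        fix j
        have "u ^ e * poly (residue_part r e f) (\<omega> ^ j * (y / u)) =
            poly (residue_part r e f) (u * (\<omega> ^ j * (y / u)))"
          by (rule poly_residue_part_mult[OF u, symmetric])
        also have "u * (\<omega> ^ j * (y / u)) = \<omega> ^ j * y" using \<open>u \<noteq> 0\<close> by simp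
        finally show "poly (A (Suc j)) (y / u) *
          (u ^ e * poly (residue_part r e f) (\<omega> ^ j * (y / u)) + poly h (\<omega> ^ j * y)) =
          poly (A (Suc j)) (y / u) * poly f (\<omega> ^ j * y)"
          using poly_f[of "\<omega> ^ j * y"] by simp
      qed
      also have "\<dots> = 0"
      proof (intro sum.neutral ballI)
        fix j assume "j \<in> {..<w}"
        then have "t + j < s" using it(2) T_le by auto
        then have "poly f (\<omega> ^ (s * i + (t + j))) = 0" using it(4) by blast
        then show "poly (A (Suc j)) (y / u) * poly f (\<omega> ^ j * y) = 0"
          by (simp add: it(3) power_add mult_ac)
      qed
      finally show ?thesis .
    qed
    have "R = 0"
    proof (rule ccontr)
      assume "R \<noteq> 0"
      have "coeff R i = 0" if "i \<ge> z * T" for i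
      proof -
        have "coeff (A (Suc j) * pcompose h [:0, u * \<omega> ^ j:]) i = 0" for j
        proof (rule coeff_mult_above_bounds[of "D - 1" _ "l - 1"])
          show "\<forall>i>D - 1. coeff (A (Suc j)) i = 0" using A(2)[of "Suc j"] by (auto simp: d_def)
          show "\<forall>i>l - 1. coeff (pcompose h [:0, u * \<omega> ^ j:]) i = 0"
            using low by (auto simp: coeff_pcompose_linear coeff_h)
          show "D - 1 + (l - 1) < i" using that zT \<open>D > 0\<close> by linarith
        qed
        then show ?thesis using A(2)[of 0] that by (simp add: R_def coeff_sum d_def)
      qed
      then have "card {x. poly R x = 0} < z * T" using \<open>R \<noteq> 0\<close> by (intro card_roots_less) auto
      moreover have "card ((\<lambda>y. y / u) ` pt ` (?Z \<times> {..<T})) = z * T"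
      proof -
        have "inj_on pt (?Z \<times> {..<T})"
          by (rule inj_on_subset[OF inj_pt]) (use T_le(2) in \<open>auto simp: N_def\<close>)
        moreover have "inj_on (\<lambda>y. y / u) (pt ` (?Z \<times> {..<T}))"
          using \<open>u \<noteq> 0\<close> by (auto simp: inj_on_def)
        ultimately show ?thesis by (simp add: card_image card_cartesian_product z)
      qed
      moreover have "card ((\<lambda>y. y / u) ` pt ` (?Z \<times> {..<T})) \<le> card {x. poly R x = 0}"
        using root poly_roots_finite[OF \<open>R \<noteq> 0\<close>] by (intro card_mono) blast+
      ultimately show False by linarith
    qed
    have dil: "pcompose (residue_part r a f) [:0, u * c:] =
        smult (u ^ a) (pcompose (residue_part r a f) [:0, c:])" for a c
    proof (rule poly_eqI)
      fix i
      have "u ^ i = u ^ (i mod r)"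
        by (metis u div_mult_mod_eq mult.commute mult_1 power_add power_mult power_one)
      then show "coeff (pcompose (residue_part r a f) [:0, u * c:]) i =
        coeff (smult (u ^ a) (pcompose (residue_part r a f) [:0, c:])) i"
        by (simp add: coeff_pcompose_linear coeff_residue_part power_mult_distrib mult_ac)
    qed
    have "R = smult (u ^ e) (A 0) + (\<Sum>j<w. \<Sum>a\<in>{..<r} - {e}.
        smult (u ^ a) (A (Suc j) * pcompose (residue_part r a f) [:0, \<omega> ^ j:]))"
      by (simp add: R_def h_def pcompose_sum dil sum_distrib_left)
    also have "\<dots> = smult (u ^ e) (A 0) + (\<Sum>a\<in>{..<r} - {e}. smult (u ^ a) (F a))"
      by (subst sum.swap) (simp add: F_def smult_sum_right)
    also have "\<dots> = (\<Sum>a<r. smult (u ^ a) (F a))"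
      using e by (subst (2) sum.remove[of _ e]) (auto simp: F_def)
    finally show ?thesis using \<open>R = 0\<close> by simp
  qed
  have F_0: "F a = 0" if "a < r" for a
    using sum_smult_powers_eq_0[of r "{u. u ^ r = 1}" F a] F_comb that card_roots_of_unity[OF r] by simp
  \<comment> \<open>The degrees lie in different residue classes and are below the order
    \<open>n\<close> of \<open>\<omega>\<close>, so the powers
    \<open>\<omega> ^ degree (residue_part r a f)\<close> are distinct.\<close>
  have deg: "degree (residue_part r a f) < n \<and> degree (residue_part r a f) mod r = a" if "a \<in> ?I" for a
  proof -
    let ?d = "degree (residue_part r a f)"
    have "coeff (residue_part r a f) ?d \<noteq> 0" using that by simp
    then have d: "?d mod r = a" "coeff f ?d \<noteq> 0" by (simp_all add: coeff_residue_part split: if_splits)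
    then have "?d < l" using low[of ?d] that by (cases "?d < l") auto
    then show ?thesis using d l by simp
  qed
  have "A (Suc j) = 0" if "j < w" for j
  proof (rule sum_dilations_eq_0[of ?I w "\<lambda>a. residue_part r a f" \<omega> "\<lambda>j. A (Suc j)"])
    show "inj_on (\<lambda>a. \<omega> ^ degree (residue_part r a f)) ?I"
    proof (rule inj_onI)
      fix a b
      assume ab: "a \<in> ?I" "b \<in> ?I"
        and eq: "\<omega> ^ degree (residue_part r a f) = \<omega> ^ degree (residue_part r b f)"
      have lt: "degree (residue_part r a f) < n" "degree (residue_part r b f) < n"
        and "a = degree (residue_part r a f) mod r" "b = degree (residue_part r b f) mod r"
        using deg[OF ab(1)] deg[OF ab(2)] by presburger+
      moreover have "degree (residue_part r a f) = degree (residue_part r b f)"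
        using eq unfolding generator_power_eq_iff mod_less[OF lt(1)] mod_less[OF lt(2)] .
      ultimately show "a = b" by presburger
    qed
    show "(\<Sum>j<w. A (Suc j) * pcompose (residue_part r a f) [:0, \<omega> ^ j:]) = 0" if "a \<in> ?I" for a
      using F_0[of a] that by (simp add: F_def)
  qed (use that w in auto)
  moreover have "A 0 = 0" using F_0[OF e] by (simp add: F_def)
  ultimately have "A j = 0" if "j \<le> w" for j using that by (cases j) auto
  then show False using A(3) by auto
qed


section \<open>Folded weight and the dual code\<close>

text \<open>Every support point \<open>\<omega> ^ k\<close> lies in block \<open>k div s\<close>,
  which is then counted by the folded weight and holds \<open>s\<close> positions.\<close>

lemma card_support_le_folded_weight:
  assumes "s dvd n"
  shows "card {x. x \<noteq> 0 \<and> poly f x \<noteq> 0} \<le> s * folded_weight \<omega> s (ev_nz f)"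
proof -
  let ?B = "{i. i < n div s \<and> (\<exists>j<s. ev_nz f (\<omega> ^ (s * i + j)) \<noteq> 0)}"
  have s: "s > 0" using assms n_pos by (auto intro: Nat.gr0I)
  have "{x. x \<noteq> 0 \<and> poly f x \<noteq> 0} \<subseteq> (\<lambda>(i, j). \<omega> ^ (s * i + j)) ` (?B \<times> {..<s})"
  proof
    fix x assume x: "x \<in> {x. x \<noteq> 0 \<and> poly f x \<noteq> 0}"
    then have "x \<in> UNIV - {0}" by simp
    then obtain k where k: "k < n" "x = \<omega> ^ k" unfolding nonzero_elements by auto
    then have "k div s < n div s" using assms s by (simp add: less_mult_imp_div_less)
    moreover have "x = \<omega> ^ (s * (k div s) + k mod s)" using k by simp
    ultimately show "x \<in> (\<lambda>(i, j). \<omega> ^ (s * i + j)) ` (?B \<times> {..<s})"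
      using x s by (intro image_eqI[of _ _ "(k div s, k mod s)"])
        (auto simp: ev_nz_def intro!: exI[of _ "k mod s"])
  qed
  then have "card {x. x \<noteq> 0 \<and> poly f x \<noteq> 0} \<le> card (?B \<times> {..<s})"
    by (intro surj_card_le) auto
  then show ?thesis by (simp add: card_cartesian_product folded_weight_def n_eq mult.commute)
qed

lemma folded_weight_eq:
  "folded_weight \<omega> s (ev_nz f) + card {i. i < n div s \<and> (\<forall>j<s. poly f (\<omega> ^ (s * i + j)) = 0)}
     = n div s"
proof -
  let ?Z = "{i. i < n div s \<and> (\<forall>j<s. poly f (\<omega> ^ (s * i + j)) = 0)}"
  let ?B = "{i. i < n div s \<and> (\<exists>j<s. ev_nz f (\<omega> ^ (s * i + j)) \<noteq> 0)}"
  have "card (?B \<union> ?Z) = card ?B + card ?Z"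
    by (rule card_Un_disjoint) (auto simp: ev_nz_def)
  moreover have "?B \<union> ?Z = {..<n div s}" by (auto simp: ev_nz_def)
  ultimately show ?thesis by (simp add: folded_weight_def n_eq)
qed

text \<open>Codewords have no exponents congruent to -1 modulo $r$, so no product of their monomials with
  those of $f$ has an exponent divisible by $n$.\<close>

lemma ev_nz_in_dual_TB_code:
  fixes f :: "'a poly"
  assumes r: "r dvd n" "r \<ge> 3" and f: "\<And>i. coeff f i \<noteq> 0 \<Longrightarrow> i mod r = 1"
  shows "ev_nz f \<in> dual_code (TB_code r l)"
proof -
  have "(\<Sum>x\<in>UNIV - {0}. poly g x * poly f x) = 0"
    if g: "\<forall>i. coeff g i \<noteq> 0 \<longrightarrow> i \<in> TB_S (card (UNIV :: 'a set)) r l" for g :: "'a poly"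
  proof -
    have ndvd: "\<not> n dvd i + j" if "coeff g i \<noteq> 0" "coeff f j \<noteq> 0" for i j
    proof
      assume "n dvd i + j"
      with r have "(i + j) mod r = 0" by (meson dvd_imp_mod_0 dvd_trans)
      \<comment> \<open>As \<open>r \<ge> 3\<close>, the class 1 is not the class
        \<open>r - 1\<close>, so the second set in \<open>TB_S\<close> avoids it too.\<close>
      moreover have "i mod r \<noteq> r - 1" using g that(1) r(2) by (auto simp: TB_S_def)
      moreover have "i mod r < r" using r(2) by simp
      ultimately show False using f[OF that(2)] r(2)
        using mod_add_right_eq[of i j r] mod_add_right_eq[of i 1 r] mod_Suc[of i r]
        by (auto split: if_splits)
    qed
    have "(\<Sum>x\<in>UNIV - {0}. poly g x * poly f x) =
        (\<Sum>x\<in>UNIV - {0}. \<Sum>i\<le>degree g. \<Sum>j\<le>degree f. coeff g i * coeff f j * x ^ (i + j))"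
      unfolding poly_altdef sum_product by (simp add: power_add mult_ac)
    also have "\<dots> = (\<Sum>i\<le>degree g. \<Sum>j\<le>degree f. coeff g i * coeff f j * (\<Sum>x\<in>UNIV - {0}. x ^ (i + j)))"
      by (subst sum.swap, intro sum.cong refl, subst sum.swap) (simp add: sum_distrib_left)
    also have "\<dots> = 0"
    proof (intro sum.neutral ballI)
      fix i j
      show "coeff g i * coeff f j * (\<Sum>x\<in>UNIV - {0}. x ^ (i + j)) = 0"
        using ndvd[of i j] sum_power_eq_0[of "i + j"]
        by (cases "coeff g i = 0 \<or> coeff f j = 0") auto
    qed
    finally show ?thesis .
  qed
  then show ?thesis by (auto simp: dual_code_def TB_code_def ev_nz_def)
qed

end

section \<open>Real arithmetic for the second term of the minimum\<close>

text \<open>With \<open>T = s + 2 - m\<close> and \<open>\<rho> = L / (N * s)\<close>,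
  \<open>bound\<close> gives \<open>z \<le> N * (1 / m + \<rho> * s / T)\<close>. The correction
  \<open>\<rho> * s / T\<close> is at most \<open>\<rho> + (m - 1) / s\<close> once the latter is
  below 1. Otherwise the claimed bound is at least \<open>N\<close>, hence at least
  \<open>z\<close>.\<close>

lemma folded_rate_arith:
  fixes N s m z L :: real
  assumes pos: "N > 0" "s > 0" "m \<ge> 1" "L \<ge> 0" and zN: "z \<le> N"
    and bound: "m - 1 \<le> s \<Longrightarrow> (z * (s + 2 - m) - L) * m \<le> N * (s + 2 - m)"
  shows "z \<le> N * (L / (N * s) + (1 / m + (m - 1) / s))"
proof (cases "L / (N * s) + (m - 1) / s < 1")
  case False
  have "N * 1 \<le> N * (L / (N * s) + (1 / m + (m - 1) / s))"
    using False pos by (intro mult_left_mono) (auto intro: order_trans[of _ "L / (N * s) + (m - 1) / s"])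
  then show ?thesis using zN by linarith
next
  case True
  define \<rho> where "\<rho> = L / (N * s)"
  define T where "T = s + 2 - m"
  have \<rho>: "\<rho> \<ge> 0" "L = \<rho> * N * s" using pos by (auto simp: \<rho>_def)
  have lt: "\<rho> * s + (m - 1) < s" using True pos by (simp add: \<rho>_def[symmetric] field_simps)
  moreover have "\<rho> * s \<ge> 0" using \<rho> pos by simp
  ultimately have "m - 1 < s" by linarith
  then have T: "T > 0" by (simp add: T_def)
  have "\<rho> * s * s \<le> (\<rho> * s + (m - 1)) * T"
  proof -
    \<comment> \<open>This is the target inequality after expanding \<open>T\<close> and cancelling.
      The assumption of this case amounts to \<open>\<rho> * s < T - 1\<close>.\<close>
    have "\<rho> * s * (m - 2) \<le> T * (m - 1)"
    proof (cases "m \<ge> 2")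
      case True
      then have "\<rho> * s * (m - 2) \<le> T * (m - 2)"
        using lt by (intro mult_right_mono) (auto simp: T_def)
      also have "\<dots> \<le> T * (m - 1)" using T by (intro mult_left_mono) auto
      finally show ?thesis .
    next
      case False
      then have "\<rho> * s * (m - 2) \<le> 0" using \<rho> pos by (intro mult_nonneg_nonpos) auto
      also have "0 \<le> T * (m - 1)" using T pos by simp
      finally show ?thesis .
    qed
    then show ?thesis by (simp add: T_def algebra_simps)
  qed
  then have *: "\<rho> * s / T \<le> \<rho> + (m - 1) / s" using T pos by (simp add: field_simps)
  have "(z * T - L) * m \<le> N * T" using bound \<open>m - 1 < s\<close> by (simp add: T_def)
  then have "z \<le> N * (1 / m + \<rho> * s / T)" using T pos by (simp add: \<rho>(2) field_simps)
  also have "\<dots> \<le> N * (\<rho> + (1 / m + (m - 1) / s))" using * pos by (intro mult_left_mono) auto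
  finally show ?thesis by (simp add: \<rho>_def)
qed

section \<open>Combining both bounds into the distance bound\<close>

theorem theorem6p3:
  fixes \<omega> :: "'a::{finite,field}" and r l s :: nat
  defines "q \<equiv> card (UNIV :: 'a set)"
  assumes r_prime: "prime r" and r_dvd: "r dvd (q - 1)" and r_ge: "r \<ge> 3"
    and l_lo: "real q / 2 \<le> real l" and l_hi: "l \<le> q - 1"
    and s_dvd: "s dvd ((q - 1) div r)"
    and gen: "is_generator \<omega>"
    and uncertainty: "\<And>f :: 'a poly. f \<noteq> 0 \<Longrightarrow> degree f < r \<Longrightarrow>
        card {i. coeff f i \<noteq> 0} + card {x :: 'a. x \<noteq> 0 \<and> x ^ r = 1 \<and> poly f x \<noteq> 0} \<ge> r + 1"
  shows "\<forall>c \<in> TB_code r l - dual_code (TB_code r l). real (folded_weight \<omega> s c)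
           \<ge> (real q - 1) / real s * (1 - (real l - 1) / (real q - 1) - TB_eps q r l s)"
proof
  fix c :: "'a \<Rightarrow> 'a" assume c: "c \<in> TB_code r l - dual_code (TB_code r l)"
  define n where "n = q - 1"
  interpret field_generator \<omega> n
    using gen by unfold_locales (simp_all add: n_def q_def)
  have r: "r dvd n" and s_n: "s dvd n div r" and l_n: "l \<le> n"
    using r_dvd s_dvd l_hi unfolding n_def by simp_all
  have q: "real q = real n + 1" using n_pos by (simp add: n_def)
  have l: "1 \<le> l" using l_lo q by simp
  have "n div r dvd n" using dvd_triv_left[of "n div r" r] r by simp
  with s_n have s: "s dvd n" by (rule dvd_trans)
  define N where "N = n div s"
  have Ns: "N * s = n" using s by (simp add: N_def)
  then have pos: "s > 0" "N > 0" using n_pos by (auto intro: Nat.gr0I)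
  have real_n: "real n = real N * real s" using Ns by (metis of_nat_mult)
  obtain f :: "'a poly" where f: "c = ev_nz f" "\<And>i. coeff f i \<noteq> 0 \<Longrightarrow> i \<in> TB_S q r l"
    using c by (auto simp: TB_code_def q_def)
  have low: "coeff f i = 0" if "i \<ge> l" "i mod r \<noteq> 1" for i
    using f(2)[of i] that by (auto simp: TB_S_def)
  let ?I = "{a. a < r \<and> a \<noteq> 1 \<and> residue_part r a f \<noteq> 0}"
  define w where "w = card ?I"
  \<comment> \<open>The extra 1 accounts for the residue class 1, whose part may or may not
    vanish.\<close>
  define m where "m = w + 1"
  have "?I \<noteq> {}"
  proof
    assume empty: "?I = {}"
    have "i mod r = 1" if "coeff f i \<noteq> 0" for i
    proof (rule ccontr)
      assume "i mod r \<noteq> 1"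
      moreover have "i mod r \<notin> ?I" unfolding empty by simp
      moreover have "i mod r < r" using r_ge by simp
      ultimately have "residue_part r (i mod r) f = 0" by blast
      then show False using that coeff_residue_part[of r "i mod r" f i] by simp
    qed
    then have "c \<in> dual_code (TB_code r l)"
      unfolding f(1) using r r_ge by (intro ev_nz_in_dual_TB_code)
    then show False using c by simp
  qed
  then obtain e where e: "e \<in> ?I" by blast
  have w: "0 < w" using \<open>?I \<noteq> {}\<close> by (simp add: w_def card_gt_0_iff)
  have "?I \<subseteq> {..<r} - {1}" by auto
  then have "w \<le> card ({..<r} - {1})" unfolding w_def by (intro card_mono) auto
  then have m_r: "m \<le> r" using r_ge by (simp add: m_def)
  define W where "W = folded_weight \<omega> s c"
  have "card {a. a < r \<and> residue_part r a f \<noteq> 0} \<le> card (insert 1 ?I)"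
    by (intro card_mono) auto
  also have "\<dots> = m" by (simp add: m_def w_def)
  finally have "(n + 1 - l) * (r + 1 - m) \<le> r * card {x. x \<noteq> 0 \<and> poly f x \<noteq> 0}"
    using e low uncertainty
    by (intro uncertainty_weight_bound[OF r, where e = e]) (auto simp: coeff_residue_part)
  also have "\<dots> \<le> r * (s * W)"
    unfolding W_def f(1) by (intro mult_le_mono2 card_support_le_folded_weight s)
  finally have "real ((n + 1 - l) * (r + 1 - m)) \<le> real (r * (s * W))" by (rule of_nat_mono)
  then have b1: "(real n + 1 - real l) * (real r + 1 - real m) \<le> real r * (real s * real W)"
  proof -
    have "real (n + 1 - l) = real n + 1 - real l" "real (r + 1 - m) = real r + 1 - real m"
      using l_n m_r by (simp_all add: of_nat_diff)
    then show ?thesis using \<open>real ((n + 1 - l) * (r + 1 - m)) \<le> real (r * (s * W))\<close>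
      by (simp only: of_nat_mult)
  qed
  define \<rho> where "\<rho> = (real l - 1) / real n"
  have bound1: "real N * (1 - \<rho> - (1 - \<rho>) * (real m - 1) / real r) \<le> real W"
  proof -
    \<comment> \<open>The bracket factors as \<open>(1 - \<rho>) * (r + 1 - m) / r\<close>, and
      \<open>N * (1 - \<rho>) = (n + 1 - l) / s\<close>.\<close>
    have "real N * (1 - \<rho> - (1 - \<rho>) * (real m - 1) / real r) =
        (real n + 1 - real l) * (real r + 1 - real m) / (real r * real s)"
      using pos r_ge by (simp add: \<rho>_def real_n field_simps)
    also have "\<dots> \<le> real W" using b1 pos r_ge by (simp add: field_simps)
    finally show ?thesis .
  qed
  define z where "z = card {i. i < n div s \<and> (\<forall>j<s. poly f (\<omega> ^ (s * i + j)) = 0)}"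
  have Wz: "W + z = N" unfolding W_def z_def N_def f(1) by (rule folded_weight_eq)
  have "real z \<le> real N * ((real l - 1) / (real N * real s) + (1 / real m + (real m - 1) / real s))"
  proof (rule folded_rate_arith)
    assume "real m - 1 \<le> real s"
    then have ws: "w \<le> s" by (simp add: m_def)
    have T: "real s + 2 - real m = real (s + 1 - w)" using ws by (simp add: m_def of_nat_diff)
    have "(z * (s + 1 - w) - (l - 1)) * (w + 1) \<le> N * (s + 1 - w)"
      unfolding N_def using r s_n l l_n r_ge low w ws
      by (intro folded_vanishing_bound[where f = f and e = 1 and r = r]) (auto simp: w_def z_def)
    then have "real ((z * (s + 1 - w) - (l - 1)) * (w + 1)) \<le> real (N * (s + 1 - w))"
      by (rule of_nat_mono)
    then have "real (z * (s + 1 - w) - (l - 1)) * real m \<le> real N * (real s + 2 - real m)"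
      unfolding T by (simp only: m_def of_nat_mult)
    \<comment> \<open>Truncated subtraction on naturals can only exceed the real difference, which
      is the direction required.\<close>
    moreover have "real z * (real s + 2 - real m) - (real l - 1) \<le> real (z * (s + 1 - w) - (l - 1))"
    proof -
      have "real z * (real s + 2 - real m) = real (z * (s + 1 - w))" unfolding T by simp
      moreover have "real l - 1 = real (l - 1)" using l by simp
      ultimately show ?thesis by linarith
    qed
    then have "(real z * (real s + 2 - real m) - (real l - 1)) * real m
        \<le> real (z * (s + 1 - w) - (l - 1)) * real m" by (rule mult_right_mono) simp
    ultimately show "(real z * (real s + 2 - real m) - (real l - 1)) * real m
        \<le> real N * (real s + 2 - real m)" by linarith
  qed (use pos l Wz in \<open>auto simp: m_def\<close>)
  then have "real z \<le> real N * (\<rho> + (1 / real m + (real m - 1) / real s))"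
    unfolding \<rho>_def real_n .
  moreover have "real W + real z = real N" unfolding Wz[symmetric] by simp
  moreover have "real N * (1 - \<rho> - (1 / real m + (real m - 1) / real s)) =
      real N - real N * (\<rho> + (1 / real m + (real m - 1) / real s))"
    unfolding diff_diff_eq right_diff_distrib by simp
  ultimately have bound2: "real N * (1 - \<rho> - (1 / real m + (real m - 1) / real s)) \<le> real W"
    by linarith
  \<comment> \<open>The value \<open>m\<close> of this codeword lies in \<open>{1..r}\<close>, so
    its minimum is among those maximised over. Both bounds hold for this \<open>m\<close>, hence so
    does the one belonging to the smaller term.\<close>
  have "min ((1 - \<rho>) * (real m - 1) / real r) (1 / real m + (real m - 1) / real s) \<le> TB_eps q r l s"
    unfolding TB_eps_def using m_r by (intro Max_ge) (auto simp: \<rho>_def q m_def intro!: image_eqI[of _ _ m])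
  then have "real N * (1 - \<rho> - TB_eps q r l s) \<le>
      real N * (1 - \<rho> - min ((1 - \<rho>) * (real m - 1) / real r) (1 / real m + (real m - 1) / real s))"
    by (intro mult_left_mono) auto
  also have "\<dots> \<le> real W" using bound1 bound2 by (simp add: min_def)
  finally show "real (folded_weight \<omega> s c)
      \<ge> (real q - 1) / real s * (1 - (real l - 1) / (real q - 1) - TB_eps q r l s)"
    using pos by (simp add: W_def \<rho>_def q real_n)
qed

end
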